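(* The $(7,4)$-spectrum is the set of all even integers greater than or equal to $14$, that is, $\{14,16,18,\dots\}$, and $N(7,4)=14$.
   Context: Graphs are finite and simple. For integers $k\ge 3$, $g\ge 3$, a $(k,g)$-graph is a $k$-regular graph of girth exactly $g$. The $(k,g)$-spectrum is the set of all integers $n$ such that there exists a connected $(k,g)$-graph of order $n$. For odd $k$, $N(k,g)$ denotes the smallest element $N$ of the $(k,g)$-spectrum such that all even integers $n\ge N$ belong to the $(k,g)$-spectrum. *)

theory Defs
  imports "Graph_Theory.Graph_Theory" "HOL-Library.Extended_Nat"
begin

text \<open>
  Finite simple graphs are \<^locale>\<open>pair_graph\<close>s: finite, loop-free digraphs without parallel arcs
  whose arc relation is symmetric, so an edge {u, v} is the pair of arcs (u, v), (v, u).
  Hence the degree of a vertex is its out-degree.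
\<close>

definition regular_graph :: "nat \<Rightarrow> 'a pair_pre_digraph \<Rightarrow> bool" where
  "regular_graph k G \<longleftrightarrow> (\<forall>v \<in> pverts G. out_degree (with_proj G) v = k)"

text \<open>
  The library's cycles are directed, so in a symmetric digraph each edge gives a cycle
  (u, v), (v, u) of length 2. The bound on the length excludes these; the remaining cycles are
  the (oriented, rooted) cycles of the undirected graph. The girth of a forest is infinite.
\<close>

definition girth :: "'a pair_pre_digraph \<Rightarrow> enat" where
  "girth G = Inf {enat (length p) | p. pre_digraph.cycle (with_proj G) p \<and> 3 \<le> length p}"

definition kg_graph :: "nat \<Rightarrow> nat \<Rightarrow> 'a pair_pre_digraph \<Rightarrow> bool" where
  "kg_graph k g G \<longleftrightarrow> pair_graph G \<and> regular_graph k G \<and> girth G = enat g"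

text \<open>
  Taking the vertices to be natural numbers is no restriction, as the graphs are finite.
\<close>

definition spectrum :: "nat \<Rightarrow> nat \<Rightarrow> nat set" where
  "spectrum k g = {n. \<exists>G :: nat pair_pre_digraph.
     kg_graph k g G \<and> Digraph_Component.connected (with_proj G) \<and> card (pverts G) = n}"

definition spectrum_N :: "nat \<Rightarrow> nat \<Rightarrow> nat" where
  "spectrum_N k g =
     (LEAST N. N \<in> spectrum k g \<and> (\<forall>n \<ge> N. even n \<longrightarrow> n \<in> spectrum k g))"

end

theory Submission
  imports Defs "HOL-Number_Theory.Cong"
begin

text \<open>
  The value 7 enters only through being odd and at least 3: for every such k the (k,4)-spectrum
  consists of the even integers from 2k on.

  Necessity. In a triangle-free graph the neighbourhoods of two adjacent vertices are disjoint, so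
  a k-regular one has at least 2k vertices (\<open>card_verts_ge_if_triangle_free\<close>). The number of arcs,
  k times the order, is twice the number of edges; as k is odd, the order is even
  (\<open>even_card_verts_if_odd_regular\<close>).

  Sufficiency. A single family of graphs realises all orders. For even n \<open>\<ge>\<close> 2k, join
  residues x and y modulo n if x + y is congruent to one of the k odd numbers 1, 3, ..., 2k - 1.
  As n is even, parity of residues is well defined and makes this graph bipartite, which excludes
  loops and triangles; for each of the k sums every vertex has exactly one neighbour; 0, 1, 2, 3
  is a 4-cycle; and x, 1 - x, x + 2 is a walk, which gives connectedness.
\<close>

section \<open>Girth 4\<close>

lemma (in pair_graph) triangle_free_if_girth_gt_3:
  assumes "girth G > 3" "(a, b) \<in> parcs G" "(b, c) \<in> parcs G" "(c, a) \<in> parcs G"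
  shows False
proof -
  have "a \<noteq> b" "b \<noteq> c" "c \<noteq> a"
    using assms(2-4) no_loops' by auto
  then have "cycle [(a, b), (b, c), (c, a)]"
    using assms(2-4) by (auto simp: cycle_def awalk_def dest: in_arcsD1)
  then have "girth G \<le> enat (length [(a, b), (b, c), (c, a)])"
    unfolding girth_def by (intro Inf_lower) fastforce
  with assms(1) show False
    by (simp add: numeral_eq_enat numeral_3_eq_3 leD)
qed

text \<open>
  Stated through arcs, since the cycles in the definition of the girth are arc lists that carry a
  starting point: the only lists to exclude are those of length exactly 3.
\<close>
lemma girth_eq_4I:
  assumes "\<And>a b c. (a, b) \<in> parcs G \<Longrightarrow> (b, c) \<in> parcs G \<Longrightarrow> (c, a) \<in> parcs G \<Longrightarrow> False"
    and "pre_digraph.cycle (with_proj G) p" "length p = 4"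
  shows "girth G = enat 4"
  unfolding girth_def
proof (rule antisym)
  show "Inf {enat (length p) |p. pre_digraph.cycle (with_proj G) p \<and> 3 \<le> length p} \<le> enat 4"
    using assms(2,3) by (intro Inf_lower) force
  show "enat 4 \<le> Inf {enat (length p) |p. pre_digraph.cycle (with_proj G) p \<and> 3 \<le> length p}"
  proof (rule Inf_greatest, clarify)
    fix q assume q: "pre_digraph.cycle (with_proj G) q" "3 \<le> length q"
    have "length q \<noteq> 3"
    proof
      assume "length q = 3"
      then obtain e f g where "q = [e, f, g]"
        by (auto simp: numeral_3_eq_3 length_Suc_conv)
      with q(1) have "e \<in> parcs G" "f \<in> parcs G" "g \<in> parcs G"
        "snd e = fst f" "snd f = fst g" "snd g = fst e"
        by (auto simp: pre_digraph.cycle_def pre_digraph.awalk_def cas_with_proj_eq)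
      with assms(1) show False
        by (metis prod.collapse)
    qed
    with q(2) show "enat 4 \<le> enat (length q)" by simp
  qed
qed

section \<open>Constraints on the order of a regular graph\<close>
lemma out_degree_eq_card_nbrs:
  "out_degree (with_proj G) v = card {w. (v, w) \<in> parcs G}"
proof -
  have "out_arcs (with_proj G) v = Pair v ` {w. (v, w) \<in> parcs G}"
    by (auto simp: out_arcs_def)
  then show ?thesis
    by (simp add: out_degree_def card_image inj_on_def)
qed

lemma (in pair_fin_digraph) finite_nbrs: "finite {w. (v, w) \<in> parcs G}"
  by (rule finite_subset[OF _ pair_finite_verts]) (auto dest: in_arcsD2)

lemma (in pair_graph) card_verts_ge_if_triangle_free:
  assumes "regular_graph k G" "k > 0" "girth G > 3" "pverts G \<noteq> {}"
  shows "card (pverts G) \<ge> 2 * k"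
proof -
  let ?N = "\<lambda>v. {w. (v, w) \<in> parcs G}"
  have deg: "card (?N v) = k" if "v \<in> pverts G" for v
    using assms(1) that by (simp add: regular_graph_def out_degree_eq_card_nbrs)
  obtain u where u: "u \<in> pverts G" using assms(4) by blast
  with deg assms(2) have "?N u \<noteq> {}" by fastforce
  then obtain v where uv: "(u, v) \<in> parcs G" by blast
  then have v: "v \<in> pverts G" by (rule in_arcsD2)
  have "?N u \<inter> ?N v = {}"
    using triangle_free_if_girth_gt_3[OF assms(3) uv] arcs_symmetric by blast
  then have "card (?N u \<union> ?N v) = 2 * k"
    using deg[OF u] deg[OF v] finite_nbrs by (simp add: card_Un_disjoint)
  moreover have "card (?N u \<union> ?N v) \<le> card (pverts G)"
    by (intro card_mono pair_finite_verts) (auto dest: in_arcsD2)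
  ultimately show ?thesis by simp
qed

text \<open>
  Swapping the ends is an involution on the arcs without fixed points. The linear order on the
  vertices only serves to choose one arc of each edge.
\<close>
lemma even_card_arcs:
  fixes G :: "'a :: linorder pair_pre_digraph"
  assumes "pair_graph G"
  shows "even (card (parcs G))"
proof -
  interpret pair_graph G by fact
  let ?A = "{(u, v) \<in> parcs G. u < v}"
  have fin: "finite ?A"
    by (rule finite_subset[OF _ pair_finite_arcs]) auto
  have "parcs G = ?A \<union> prod.swap ` ?A"
    using arcs_symmetric no_loops' by (force simp: neq_iff)
  then have "card (parcs G) = card (?A \<union> prod.swap ` ?A)" by simp
  also have "\<dots> = card ?A + card (prod.swap ` ?A)"
    using fin by (intro card_Un_disjoint) auto
  also have "card (prod.swap ` ?A) = card ?A"
    by (simp add: card_image)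
  finally show ?thesis by simp
qed

text \<open>The handshake lemma, with arcs counted by their tails.\<close>
lemma even_card_verts_if_odd_regular:
  fixes G :: "'a :: linorder pair_pre_digraph"
  assumes "pair_graph G" "regular_graph k G" "odd k"
  shows "even (card (pverts G))"
proof -
  interpret pair_graph G by fact
  have "parcs G = Sigma (pverts G) (\<lambda>v. {w. (v, w) \<in> parcs G})"
    by (auto dest: in_arcsD1)
  then have "card (parcs G) = card (Sigma (pverts G) (\<lambda>v. {w. (v, w) \<in> parcs G}))"
    by simp
  also have "\<dots> = (\<Sum>v\<in>pverts G. card {w. (v, w) \<in> parcs G})"
    using finite_nbrs pair_finite_verts by (intro card_SigmaI) auto
  also have "\<dots> = card (pverts G) * k"
    using assms(2) by (simp add: regular_graph_def out_degree_eq_card_nbrs)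
  finally show ?thesis
    using even_card_arcs[OF assms(1)] assms(3) by simp
qed

section \<open>A family of connected bipartite regular graphs\<close>

text \<open>
  Up to the relabelling x \<open>\<mapsto>\<close> -x of one side, this is the bipartite graph on two copies of the
  integers modulo n/2 in which i is joined to i, i + 1, ..., i + k - 1; for n = 2k it is complete
  bipartite. A condition on the sum instead of the difference makes the arc relation symmetric at
  sight, without a distinction of the two sides.
\<close>
definition odd_sum_graph :: "nat \<Rightarrow> nat \<Rightarrow> nat pair_pre_digraph" where
  "odd_sum_graph k n = \<lparr>pverts = {..<n},
     parcs = {(x, y). x < n \<and> y < n \<and> odd ((x + y) mod n) \<and> (x + y) mod n < 2 * k}\<rparr>"

lemma pverts_odd_sum_graph [simp]: "pverts (odd_sum_graph k n) = {..<n}"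
  by (simp add: odd_sum_graph_def)

lemma arcs_odd_sum_graph:
  "(x, y) \<in> parcs (odd_sum_graph k n) \<longleftrightarrow>
     x < n \<and> y < n \<and> odd ((x + y) mod n) \<and> (x + y) mod n < 2 * k"
  by (simp add: odd_sum_graph_def)

lemma arcs_odd_sum_graph_parity:
  assumes "even n" "(x, y) \<in> parcs (odd_sum_graph k n)"
  shows "odd (x + y)"
  using assms by (simp add: arcs_odd_sum_graph dvd_mod_iff)

lemma pair_graph_odd_sum_graph:
  assumes "even n"
  shows "pair_graph (odd_sum_graph k n)"
proof
  fix e assume "e \<in> parcs (odd_sum_graph k n)"
  then show "fst e \<in> pverts (odd_sum_graph k n)" "snd e \<in> pverts (odd_sum_graph k n)"
    "fst e \<noteq> snd e"
    using arcs_odd_sum_graph_parity[OF assms, of "fst e" "snd e" k]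
    by (auto simp: odd_sum_graph_def)
next
  show "finite (parcs (odd_sum_graph k n))"
    by (rule finite_subset[of _ "{..<n} \<times> {..<n}"]) (auto simp: odd_sum_graph_def)
  show "symmetric (with_proj (odd_sum_graph k n))"
    by (auto simp: symmetric_def sym_def arcs_odd_sum_graph add.commute)
qed simp

text \<open>
  Translation by x permutes the residues, so the neighbours of x correspond to the admissible
  values of the sum.
\<close>
lemma inj_on_add_mod: "inj_on (\<lambda>y. (x + y) mod n) {..<n}" for n :: nat
proof (rule inj_onI)
  fix y z assume "y \<in> {..<n}" "z \<in> {..<n}" "(x + y) mod n = (x + z) mod n"
  then have "cong (x + y) (x + z) n" "y < n" "z < n"
    by (auto simp: cong_def)
  then show "y = z"
    by (simp add: cong_add_lcancel_nat cong_less_modulus_unique_nat)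
qed

lemma regular_odd_sum_graph:
  assumes "2 * k \<le> n"
  shows "regular_graph k (odd_sum_graph k n)"
  unfolding regular_graph_def out_degree_eq_card_nbrs
proof
  fix x assume "x \<in> pverts (odd_sum_graph k n)"
  then have x: "x < n" by simp
  let ?f = "\<lambda>y. (x + y) mod n" and ?N = "{y. (x, y) \<in> parcs (odd_sum_graph k n)}"
  let ?S = "{s. odd s \<and> s < 2 * k}"
  have "?f ` {..<n} = {..<n}"
    using x by (intro card_subset_eq) (auto simp: card_image inj_on_add_mod)
  moreover have "?f ` ?N = ?f ` {..<n} \<inter> ?S"
    using x by (auto simp: arcs_odd_sum_graph)
  moreover have "{..<n} \<inter> ?S = ?S"
    using assms by auto
  ultimately have "?f ` ?N = ?S"
    by simp
  moreover have "inj_on ?f ?N"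
    by (rule inj_on_subset[OF inj_on_add_mod]) (auto simp: arcs_odd_sum_graph)
  moreover have "?S = (\<lambda>i. 2 * i + 1) ` {..<k}"
  proof (intro equalityI subsetI)
    fix s assume "s \<in> ?S"
    then obtain i where "s = 2 * i + 1" "s < 2 * k" by (blast elim: oddE)
    then show "s \<in> (\<lambda>i. 2 * i + 1) ` {..<k}" by (intro image_eqI[of _ _ i]) auto
  qed auto
  ultimately have "card ?N = card ((\<lambda>i. 2 * i + 1) ` {..<k})"
    using card_image[of ?f ?N] by simp
  also have "\<dots> = k"
    by (simp add: card_image inj_on_def)
  finally show "card ?N = k" .
qed

lemma girth_odd_sum_graph:
  assumes "k \<ge> 3" "even n" "2 * k \<le> n"
  shows "girth (odd_sum_graph k n) = enat 4"
proof (rule girth_eq_4I)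
  fix a b c
  assume "(a, b) \<in> parcs (odd_sum_graph k n)" "(b, c) \<in> parcs (odd_sum_graph k n)"
    "(c, a) \<in> parcs (odd_sum_graph k n)"
  then have "odd (a + b)" "odd (b + c)" "odd (c + a)"
    using arcs_odd_sum_graph_parity[OF assms(2)] by blast+
  then show False by auto
next
  show "pre_digraph.cycle (with_proj (odd_sum_graph k n)) [(0, 1), (1, 2), (2, 3), (3, 0)]"
    using assms
    by (auto simp: pre_digraph.cycle_def pre_digraph.awalk_def cas_with_proj_eq
        awalk_verts_with_proj_eq arcs_odd_sum_graph)
qed simp

lemma (in pair_graph) connected_if_reachable_from:
  assumes "r \<in> pverts G" "\<And>v. v \<in> pverts G \<Longrightarrow> r \<rightarrow>\<^sup>*\<^bsub>with_proj G\<^esub> v"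
  shows "Digraph_Component.connected (with_proj G)"
proof -
  have "u \<rightarrow>\<^sup>*\<^bsub>with_proj G\<^esub> v" if "u \<in> pverts G" "v \<in> pverts G" for u v
    using symmetric_reachable'[OF assms(2)[OF that(1)]] assms(2)[OF that(2)]
    by (rule reachable_trans)
  then show ?thesis
    using assms(1) reachable_mk_symmetricI
    by (auto simp: Digraph_Component.connected_def strongly_connected_def)
qed

lemma connected_odd_sum_graph:
  assumes "k \<ge> 2" "even n" "2 * k \<le> n"
  shows "Digraph_Component.connected (with_proj (odd_sum_graph k n))"
proof -
  let ?G = "odd_sum_graph k n"
  interpret pair_graph ?G using assms(2) by (rule pair_graph_odd_sum_graph)
  \<comment> \<open>The residue of 1 - x, written so that truncated subtraction is harmless: it is joined to x by
    the sum 1 and to x + 2 by the sum 3, hence it links consecutive vertices of equal parity.\<close>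
  define reflect where "reflect x = (n + 1 - x) mod n" for x
  have n: "n \<ge> 4" using assms by simp
  have sum: "(x + reflect x) mod n = 1" if "x < n" for x
  proof -
    have "(x + reflect x) mod n = (n + 1) mod n"
      using that by (simp add: reflect_def mod_add_right_eq)
    also have "\<dots> = 1" using n by (simp only: mod_add_self1) simp
    finally show ?thesis .
  qed
  have refl_arc: "(x, reflect x) \<in> parcs ?G" if "x < n" for x
    using that n assms(1) sum[OF that] by (simp add: arcs_odd_sum_graph reflect_def)
  have step: "(reflect x, x + 2) \<in> parcs ?G" if "x + 2 < n" for x
  proof -
    have "(reflect x + (x + 2)) mod n = ((x + reflect x) mod n + 2) mod n"
      by (simp add: mod_simps ac_simps)
    also have "\<dots> = 3" using that n sum by simp
    finally show ?thesis
      using that n assms(1) by (simp add: arcs_odd_sum_graph reflect_def)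
  qed
  have even_reach: "0 \<rightarrow>\<^sup>*\<^bsub>with_proj ?G\<^esub> (2 * i)" if "2 * i < n" for i
    using that
  proof (induction i)
    case 0 then show ?case by simp
  next
    case (Suc i)
    then have "0 \<rightarrow>\<^sup>*\<^bsub>with_proj ?G\<^esub> (2 * i)" by simp
    also have "(2 * i, reflect (2 * i)) \<in> parcs ?G" using Suc.prems refl_arc by simp
    also have "(reflect (2 * i), 2 * i + 2) \<in> parcs ?G" using Suc.prems step by simp
    finally show ?case by simp
  qed
  have reach: "0 \<rightarrow>\<^sup>*\<^bsub>with_proj ?G\<^esub> x" if "x < n" for x
  proof (cases "even x")
    case True
    then obtain i where "x = 2 * i" by (rule evenE)
    with even_reach that show ?thesis by simp
  next
    case False
    have arc: "(reflect x, x) \<in> parcs ?G"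
      using refl_arc[OF that] by (rule arcs_symmetric)
    then have "odd (reflect x + x)"
      by (rule arcs_odd_sum_graph_parity[OF assms(2)])
    with False have "even (reflect x)" by simp
    then obtain i where "reflect x = 2 * i" by (rule evenE)
    with even_reach[of i] arc have "0 \<rightarrow>\<^sup>*\<^bsub>with_proj ?G\<^esub> (reflect x)"
      by (simp add: arcs_odd_sum_graph)
    also note arc
    finally show ?thesis .
  qed
  show ?thesis
    using n by (intro connected_if_reachable_from[of 0] reach) auto
qed

section \<open>The spectrum for odd degree and girth 4\<close>
theorem spectrum_odd_girth_4:
  assumes "odd k" "k \<ge> 3"
  shows "spectrum k 4 = {n. even n \<and> n \<ge> 2 * k}"
proof (intro equalityI subsetI CollectI)
  fix n assume "n \<in> spectrum k 4"
  then obtain G :: "nat pair_pre_digraph" where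
    G: "pair_graph G" "regular_graph k G" "girth G = enat 4"
    and conn: "Digraph_Component.connected (with_proj G)" and n: "n = card (pverts G)"
    by (auto simp: spectrum_def kg_graph_def)
  interpret pair_graph G by fact
  have "pverts G \<noteq> {}"
    using conn by (simp add: Digraph_Component.connected_def strongly_connected_def)
  then have "n \<ge> 2 * k"
    using card_verts_ge_if_triangle_free[OF G(2)] G(3) assms(2) n by (simp add: numeral_eq_enat)
  with even_card_verts_if_odd_regular[OF G(1,2) assms(1)] n show "even n \<and> n \<ge> 2 * k" by simp
next
  fix n assume "n \<in> {n. even n \<and> n \<ge> 2 * k}"
  then have n: "even n" "2 * k \<le> n" by auto
  then have "kg_graph k 4 (odd_sum_graph k n)"
    "Digraph_Component.connected (with_proj (odd_sum_graph k n))"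
    using assms(2) pair_graph_odd_sum_graph regular_odd_sum_graph girth_odd_sum_graph
      connected_odd_sum_graph by (simp_all add: kg_graph_def)
  then show "n \<in> spectrum k 4"
    unfolding spectrum_def by (intro CollectI exI[of _ "odd_sum_graph k n"]) simp
qed

theorem mainTheorem18:
  shows "spectrum 7 4 = {n. even n \<and> n \<ge> 14} \<and> spectrum_N 7 4 = 14"
proof
  show spec: "spectrum 7 4 = {n. even n \<and> n \<ge> 14}"
    using spectrum_odd_girth_4[of 7] by simp
  show "spectrum_N 7 4 = 14"
    unfolding spectrum_N_def spec by (rule Least_equality) auto
qed

end
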